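(* Suppose that a sequence of point cloud varifolds $(V^k)_k$, $V^k=\sum_{i=1}^Nm_i^k\,\delta_{(x_i^k,P_i^k)}$, is a solution of the implicit scheme $$x_i^{k+1}=x_i^k+\tau\,H_\varepsilon^\Pi\bigl(x_i^{k+1},\widehat{V^k}\bigr),\qquad\widehat{V^k}=\sum_{i=1}^Nm_i^k\,\delta_{(x_i^{k+1},P_i^k)},\qquad i=1,\dots,N,$$ with time step $\tau>0$. In addition, let $\nu\in\mathbb{R}^n$, $\mu\in\mathbb{R}$ and (1) assume that the initial points $X^0=\{x_i^0\}_{i=1}^N\subset\mathbb{R}^n$ fulfill $x_i^0\cdot\nu\le\mu$ for $i=1,\dots,N$; (2) for all $k$, if $x_i^k$ is a point on the boundary of the convex hull of $X^k=\{x_j^k\}_{j=1}^N$, then for points $x_j^k$ such that $|x_j^k-x_i^k|<\varepsilon$ assume (implicitly) that the vector $\Pi_{ij}^k(x_j^{k+1}-x_i^{k+1})$ at $x_i^{k+1}$ is pointing inside the convex hull of $X^{k+1}$. Then, independently of the choices of the masses $m_i^k$, $$x_i^k\cdot\nu\le\mu\qquad\text{for all }i=1,\dots,N$$ and for all $k$ such that $V^k$ is defined.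
   Context: $1\le d\le n$ are integers, $\varepsilon>0$. $\rho,\xi\in C^\infty(\mathbb{R})$ are fixed nonnegative even functions, compactly supported in $[-1,1]$, positive on $(0,1)$, $\rho$ nonincreasing on $[0,1]$, with $n\,\xi(s)=-s\,\rho'(s)$ for $s\in(-1,1)$. Masses $m_i^k=m_i(X^k)>0$ and directions $P_i^k=P_i(X^k)$ ($d$-dimensional linear subspaces of $\mathbb{R}^n$) are computed from the positions $X^k=(x_1^k,\dots,x_N^k)$ by a prescribed rule. $\Pi_P$ is the orthogonal projector onto $P$, and $\Pi_{ij}^k$ is one fixed choice among $$\Pi_{P_j},\quad-2\Pi_{P_j^\perp},\quad2\,\mathrm{Id},\quad\Pi_{P_i^\perp}\circ\Pi_{P_j},\quad-2\Pi_{P_i^\perp}\circ\Pi_{P_j^\perp},\quad2\Pi_{P_i^\perp}$$ evaluated at $P_i=P_i^k$, $P_j=P_j^k$. $H_\varepsilon^\Pi$ is the approximate mean curvature of a point cloud varifold; explicitly, the scheme reads $$x_i^{k+1}=x_i^k-\frac{\tau d}{n\varepsilon}\,\frac{\sum_{j\ne i}m_j^k\,\rho'\!\left(\frac{|x_j^{k+1}-x_i^{k+1}|}{\varepsilon}\right)\Pi_{ij}^k\!\left(\frac{x_j^{k+1}-x_i^{k+1}}{|x_j^{k+1}-x_i^{k+1}|}\right)}{\sum_{l=1}^Nm_l^k\,\xi\!\left(\frac{|x_l^{k+1}-x_i^{k+1}|}{\varepsilon}\right)},$$ where the denominators are understood to be positive and terms with $x_j^{k+1}=x_i^{k+1}$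 are zero. A vector $v$ at a point $x$ of the convex hull $\mathcal C$ of a finite set "points inside $\mathcal C$" if $x+sv\in\mathcal C$ for some $s>0$ (in particular $v=0$ is allowed). The boundary of the convex hull is its topological boundary in $\mathbb{R}^n$.
   Formalization: In (2) the boundary and distance premises are taken at the new positions: x_i^{k+1} on the boundary of the convex hull of X^{k+1} and |x_j^{k+1}-x_i^{k+1}|<ε, for each step k to k+1; with index k, as printed, an interior point can leave the hull and the claim is false. *)

theory Defs
  imports "HOL-Analysis.Analysis"
begin

definition smooth_real :: "(real \<Rightarrow> real) \<Rightarrow> bool" where
  "smooth_real f \<longleftrightarrow> (\<forall>k x. ((deriv ^^ k) f) differentiable (at x))"

definition smoothing_profile :: "(real \<Rightarrow> real) \<Rightarrow> bool" where
  "smoothing_profile f \<longleftrightarrow>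
     smooth_real f \<and> (\<forall>s. 0 \<le> f s) \<and> (\<forall>s. f (- s) = f s) \<and>
     closure {s. f s \<noteq> 0} \<subseteq> {-1..1} \<and> (\<forall>s\<in>{0<..<1}. 0 < f s)"

definition kernel_pair :: "nat \<Rightarrow> (real \<Rightarrow> real) \<Rightarrow> (real \<Rightarrow> real) \<Rightarrow> bool" where
  "kernel_pair n \<rho> \<xi> \<longleftrightarrow>
     smoothing_profile \<rho> \<and> smoothing_profile \<xi> \<and> antimono_on {0..1} \<rho> \<and>
     (\<forall>s\<in>{-1<..<1}. real n * \<xi> s = - s * deriv \<rho> s)"

text \<open>
  The varifold \<open>\<Sum>i. m\<^sub>i \<delta>\<^bsub>(x\<^sub>i, P\<^sub>i)\<^esub>\<close> is represented by its labelled data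
  \<open>(m\<^sub>i, x\<^sub>i, P\<^sub>i)\<close>, the labels ranging over a finite type with \<open>N\<close> elements.  The labels are kept
  because \<open>\<Pi>\<^sub>i\<^sub>j\<close> refers to \<open>P\<^sub>i\<close>, which the position \<open>x\<^sub>i\<close> does not determine when points coincide.
\<close>

record ('a, 'p) point_cloud =
  mass :: "'p \<Rightarrow> real"
  pos :: "'p \<Rightarrow> 'a"
  dirn :: "'p \<Rightarrow> 'a set"

definition point_cloud_varifold ::
    "nat \<Rightarrow> ('a::euclidean_space, 'p::finite) point_cloud \<Rightarrow> bool" where
  "point_cloud_varifold d V \<longleftrightarrow>
     (\<forall>i. 0 < mass V i \<and> subspace (dirn V i) \<and> dim (dirn V i) = d)"

definition orth_proj :: "'a::euclidean_space set \<Rightarrow> 'a \<Rightarrow> 'a" where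
  "orth_proj P v = (THE w. w \<in> P \<and> v - w \<in> orthogonal_comp P)"

datatype projector_choice =
    ProjJ | PerpJ | TwoId | PerpI_ProjJ | PerpI_PerpJ | PerpI

fun proj_op :: "projector_choice \<Rightarrow> 'a::euclidean_space set \<Rightarrow> 'a set \<Rightarrow> 'a \<Rightarrow> 'a" where
  "proj_op ProjJ P Q v = orth_proj Q v"
| "proj_op PerpJ P Q v = (-2) *\<^sub>R orth_proj (orthogonal_comp Q) v"
| "proj_op TwoId P Q v = 2 *\<^sub>R v"
| "proj_op PerpI_ProjJ P Q v = orth_proj (orthogonal_comp P) (orth_proj Q v)"
| "proj_op PerpI_PerpJ P Q v =
     (-2) *\<^sub>R orth_proj (orthogonal_comp P) (orth_proj (orthogonal_comp Q) v)"
| "proj_op PerpI P Q v = 2 *\<^sub>R orth_proj (orthogonal_comp P) v"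

definition Pi_op ::
    "projector_choice \<Rightarrow> ('a::euclidean_space, 'p) point_cloud \<Rightarrow> 'p \<Rightarrow> 'p \<Rightarrow> 'a \<Rightarrow> 'a" where
  "Pi_op c V i j = proj_op c (dirn V i) (dirn V j)"

definition mc_denominator ::
    "real \<Rightarrow> (real \<Rightarrow> real) \<Rightarrow> ('a::euclidean_space, 'p::finite) point_cloud \<Rightarrow> 'p \<Rightarrow> real" where
  "mc_denominator \<epsilon> \<xi> V i = (\<Sum>l\<in>UNIV. mass V l * \<xi> (norm (pos V l - pos V i) / \<epsilon>))"

text \<open>
  The approximate mean curvature of \<open>V\<close> at its own point \<open>x\<^sub>i\<close>.  A term with \<open>x\<^sub>j = x\<^sub>i\<close> vanishes, since
  the projector is then applied to \<open>0 /\<^sub>R 0 = 0\<close>.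
\<close>

definition approx_mean_curvature ::
    "nat \<Rightarrow> real \<Rightarrow> (real \<Rightarrow> real) \<Rightarrow> (real \<Rightarrow> real) \<Rightarrow> projector_choice \<Rightarrow>
     ('a::euclidean_space, 'p::finite) point_cloud \<Rightarrow> 'p \<Rightarrow> 'a" where
  "approx_mean_curvature d \<epsilon> \<rho> \<xi> c V i =
     - ((real d / (real DIM('a) * \<epsilon>)) *\<^sub>R
        ((\<Sum>j\<in>UNIV - {i}.
            (mass V j * deriv \<rho> (norm (pos V j - pos V i) / \<epsilon>)) *\<^sub>R
            Pi_op c V i j ((pos V j - pos V i) /\<^sub>R norm (pos V j - pos V i)))
         /\<^sub>R mc_denominator \<epsilon> \<xi> V i))"

text \<open>
  \<open>mrule\<close> and \<open>Prule\<close> prescribe masses and directions from the positions.  The sequence is defined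
  for the indices \<open>k \<le> K\<close>; \<open>K = \<infinity>\<close> is allowed.
\<close>

definition implicit_scheme_solution ::
    "nat \<Rightarrow> real \<Rightarrow> real \<Rightarrow> (real \<Rightarrow> real) \<Rightarrow> (real \<Rightarrow> real) \<Rightarrow> projector_choice \<Rightarrow>
     (('p \<Rightarrow> 'a) \<Rightarrow> 'p \<Rightarrow> real) \<Rightarrow> (('p \<Rightarrow> 'a) \<Rightarrow> 'p \<Rightarrow> 'a set) \<Rightarrow>
     enat \<Rightarrow> (nat \<Rightarrow> ('a::euclidean_space, 'p::finite) point_cloud) \<Rightarrow> bool" where
  "implicit_scheme_solution d \<epsilon> \<tau> \<rho> \<xi> c mrule Prule K V \<longleftrightarrow>
     (\<forall>k. enat k \<le> K \<longrightarrow>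
        point_cloud_varifold d (V k) \<and>
        mass (V k) = mrule (pos (V k)) \<and> dirn (V k) = Prule (pos (V k))) \<and>
     (\<forall>k. enat (Suc k) \<le> K \<longrightarrow>
        (let W = (V k)\<lparr>pos := pos (V (Suc k))\<rparr> in
          \<forall>i. 0 < mc_denominator \<epsilon> \<xi> W i \<and>
              pos (V (Suc k)) i = pos (V k) i + \<tau> *\<^sub>R approx_mean_curvature d \<epsilon> \<rho> \<xi> c W i))"

definition points_inside :: "'a::real_vector set \<Rightarrow> 'a \<Rightarrow> 'a \<Rightarrow> bool" where
  "points_inside C x v \<longleftrightarrow> (\<exists>s>0. x + s *\<^sub>R v \<in> C)"

text \<open>
  The condition on the step from \<open>k\<close> to \<open>k + 1\<close>, understood implicitly: being a boundary point and
  having \<open>\<epsilon>\<close>-close neighbours refer to the new positions, as the vectors and the convex hull do; only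
  the directions in \<open>\<Pi>\<^sub>i\<^sub>j\<close> are those at \<open>k\<close>.  With boundary points and neighbours taken from the old
  positions the condition would say nothing about a point that leaves the hull from its interior,
  and the half-space bound would fail.
\<close>

definition implicit_inward_condition ::
    "real \<Rightarrow> projector_choice \<Rightarrow> enat \<Rightarrow>
     (nat \<Rightarrow> ('a::euclidean_space, 'p::finite) point_cloud) \<Rightarrow> bool" where
  "implicit_inward_condition \<epsilon> c K V \<longleftrightarrow>
     (\<forall>k. enat (Suc k) \<le> K \<longrightarrow>
        (let x = pos (V (Suc k)); C = convex hull (range x) in
          \<forall>i. x i \<in> frontier C \<longrightarrow>
            (\<forall>j. norm (x j - x i) < \<epsilon> \<longrightarrow>
               points_inside C (x i) (Pi_op c (V k) i j (x j - x i)))))"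

end

theory Submission
  imports Defs
begin

text \<open>
  A step from \<open>k\<close> to \<open>k + 1\<close> does not increase the maximum of \<open>x \<bullet> \<nu>\<close> over the cloud: a new point
  \<open>x\<^sub>i\<close> attaining it lies on the boundary of the new hull, so by the inward condition every
  \<open>\<Pi>\<^sub>i\<^sub>j (x\<^sub>j - x\<^sub>i)\<close> with \<open>x\<^sub>j\<close> in the range of the kernel has nonpositive component along \<open>\<nu>\<close>.
  As \<open>\<rho>' \<le> 0\<close> on \<open>(0, 1)\<close> and \<open>\<rho>' = 0\<close> beyond, the curvature at \<open>x\<^sub>i\<close> has nonpositive component
  along \<open>\<nu>\<close>, and \<open>x\<^sub>i\<close> was at least as high before the step.
\<close>

text \<open>Two candidates differ by a vector of \<open>P\<close> that is also orthogonal to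
  \<open>P\<close>, hence to itself.\<close>

lemma orth_proj_unique:
  assumes "subspace P" "w \<in> P" "v - w \<in> orthogonal_comp P"
  shows "orth_proj P v = w"
  unfolding orth_proj_def
proof (rule the_equality)
  show "w \<in> P \<and> v - w \<in> orthogonal_comp P" using assms by simp
next
  fix u assume u: "u \<in> P \<and> v - u \<in> orthogonal_comp P"
  have "(v - w) - (v - u) \<in> orthogonal_comp P"
    using assms(3) u by (blast intro: subspace_diff subspace_orthogonal_comp)
  then have "u - w \<in> orthogonal_comp P" by simp
  moreover have "u - w \<in> P"
    using assms u by (intro subspace_diff) auto
  ultimately have "orthogonal (u - w) (u - w)"
    unfolding orthogonal_comp_def by blast
  then show "u = w" by (simp add: orthogonal_self)
qed

lemma orth_proj_properties:
  fixes P :: "'a::euclidean_space set"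
  assumes "subspace P"
  shows "orth_proj P v \<in> P" "v - orth_proj P v \<in> orthogonal_comp P"
proof -
  obtain y z where y: "y \<in> span P" "\<And>w. w \<in> span P \<Longrightarrow> orthogonal z w" "v = y + z"
    using orthogonal_subspace_decomp_exists by metis
  have P: "span P = P" using assms by simp
  have "y \<in> P" "v - y \<in> orthogonal_comp P"
    using y P by (auto simp: orthogonal_comp_def orthogonal_commute)
  then show "orth_proj P v \<in> P" "v - orth_proj P v \<in> orthogonal_comp P"
    using orth_proj_unique[OF assms] by metis+
qed

lemma orth_proj_scaleR:
  fixes P :: "'a::euclidean_space set"
  assumes "subspace P"
  shows "orth_proj P (a *\<^sub>R v) = a *\<^sub>R orth_proj P v"
proof (rule orth_proj_unique[OF assms])
  show "a *\<^sub>R orth_proj P v \<in> P"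
    using assms orth_proj_properties(1) by (intro subspace_scale)
  have "a *\<^sub>R (v - orth_proj P v) \<in> orthogonal_comp P"
    using assms by (intro subspace_scale subspace_orthogonal_comp orth_proj_properties)
  then show "a *\<^sub>R v - a *\<^sub>R orth_proj P v \<in> orthogonal_comp P"
    by (simp add: scaleR_diff_right)
qed

text \<open>The curvature applies the projectors to unit vectors, the inward condition to plain
  differences of positions. Homogeneity, inherited from the orthogonal projectors by all six
  choices, links the two.\<close>

lemma Pi_op_scaleR:
  fixes V :: "('a::euclidean_space, 'p) point_cloud"
  assumes "subspace (dirn V i)" "subspace (dirn V j)"
  shows "Pi_op c V i j (a *\<^sub>R v) = a *\<^sub>R Pi_op c V i j v"
  using assms
  by (cases c) (simp_all add: Pi_op_def orth_proj_scaleR subspace_orthogonal_comp)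

text \<open>Beyond 1 this is the support condition. At 1 itself, which the support may contain,
  continuity from the right decides.\<close>

lemma smoothing_profile_eq_0:
  assumes "smoothing_profile f" "1 \<le> s"
  shows "f s = 0"
proof (rule ccontr)
  assume "f s \<noteq> 0"
  have supp: "f t = 0" if "1 < t" for t
    using assms(1) that closure_subset[of "{s. f s \<noteq> 0}"]
    unfolding smoothing_profile_def by force
  have "(deriv ^^ 0) f differentiable at s"
    using assms(1) unfolding smoothing_profile_def smooth_real_def by blast
  then have "isCont f s"
    by (simp add: differentiable_imp_continuous_within)
  then have "(f \<longlongrightarrow> f s) (at_right s)"
    by (simp add: continuous_at filterlim_at_split)
  moreover have "(f \<longlongrightarrow> 0) (at_right s)"
    using assms(2) supp
    by (intro tendsto_eventually eventually_at_right_less[THEN eventually_mono]) auto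
  ultimately have "f s = 0" by (intro tendsto_unique) auto
  with \<open>f s \<noteq> 0\<close> show False ..
qed

text \<open>A nonnegative function has a global minimum wherever it vanishes, so its derivative is
  zero there; this covers the end point 1 as well.\<close>

lemma smoothing_profile_deriv_eq_0:
  assumes "smoothing_profile f" "1 \<le> s"
  shows "deriv f s = 0"
proof -
  have "(deriv ^^ 0) f differentiable at s"
    using assms(1) unfolding smoothing_profile_def smooth_real_def by blast
  then have "DERIV f s :> deriv f s"
    by (simp add: DERIV_deriv_iff_real_differentiable)
  moreover have "f s \<le> f t" for t
    using assms smoothing_profile_eq_0[OF assms] unfolding smoothing_profile_def by simp
  ultimately show ?thesis
    \<comment> \<open>The minimum is global, so the radius 1 of the neighbourhood is
      arbitrary.\<close>
    by (intro DERIV_local_min[of f _ s 1]) auto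
qed

text \<open>On (0, 1) the sign is read off from the relation between \<rho>' and the nonnegative
  \<xi>; from 1 on the derivative vanishes.\<close>

lemma kernel_pair_deriv_nonpos:
  assumes "kernel_pair n \<rho> \<xi>" "0 < s"
  shows "deriv \<rho> s \<le> 0"
proof (cases "s < 1")
  case True
  with assms have "real n * \<xi> s = - s * deriv \<rho> s" "0 \<le> \<xi> s"
    unfolding kernel_pair_def smoothing_profile_def by auto
  then have "s * deriv \<rho> s \<le> 0"
    by (metis minus_mult_left neg_0_le_iff_le mult_nonneg_nonneg of_nat_0_le_iff)
  with assms(2) show ?thesis by (simp add: mult_le_0_iff)
next
  case False
  with assms smoothing_profile_deriv_eq_0[of \<rho> s] show ?thesis
    unfolding kernel_pair_def by simp
qed

lemma inner_le_on_convex_hull: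
  assumes "\<And>x. x \<in> S \<Longrightarrow> x \<bullet> \<nu> \<le> b" "y \<in> convex hull S"
  shows "y \<bullet> \<nu> \<le> b"
proof -
  have "convex hull S \<subseteq> {x. \<nu> \<bullet> x \<le> b}"
    using assms(1) by (intro hull_minimal convex_halfspace_le) (auto simp: inner_commute)
  with assms(2) show ?thesis by (auto simp: inner_commute)
qed

lemma maximizer_in_frontier:
  fixes x :: "'a::euclidean_space"
  assumes "x \<in> C" "\<And>y. y \<in> C \<Longrightarrow> y \<bullet> \<nu> \<le> x \<bullet> \<nu>" "\<nu> \<noteq> 0"
  shows "x \<in> frontier C"
proof -
  have "x \<notin> interior C"
  proof
    assume "x \<in> interior C"
    then obtain e where e: "e > 0" "cball x e \<subseteq> C"
      unfolding mem_interior_cball by blast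
    \<comment> \<open>The displacement along \<nu> has length exactly \<open>e\<close>, so it stays
      in the closed ball and strictly increases the component along \<nu>.\<close>
    let ?y = "x + (e / norm \<nu>) *\<^sub>R \<nu>"
    have "?y \<in> cball x e"
      using e \<open>\<nu> \<noteq> 0\<close> by (simp add: dist_norm)
    then have "?y \<bullet> \<nu> \<le> x \<bullet> \<nu>" using e assms(2) by blast
    then have "(e / norm \<nu>) * (\<nu> \<bullet> \<nu>) \<le> 0" by (simp add: inner_add_left)
    moreover have "0 < (e / norm \<nu>) * (\<nu> \<bullet> \<nu>)" using e \<open>\<nu> \<noteq> 0\<close> by simp
    ultimately show False by simp
  qed
  then show ?thesis
    using assms(1) closure_subset unfolding frontier_def by blast
qed

lemma points_inside_inner_nonpos:
  assumes "points_inside C x v" "\<And>y. y \<in> C \<Longrightarrow> y \<bullet> \<nu> \<le> x \<bullet> \<nu>"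
  shows "v \<bullet> \<nu> \<le> 0"
proof -
  obtain s where "s > 0" "x + s *\<^sub>R v \<in> C"
    using assms(1) unfolding points_inside_def by blast
  with assms(2)[of "x + s *\<^sub>R v"] show ?thesis
    by (simp add: inner_add_left mult_le_0_iff)
qed

lemma approx_mean_curvature_inner_nonpos:
  fixes W :: "('a::euclidean_space, 'p::finite) point_cloud"
  assumes "0 < \<epsilon>" "kernel_pair n \<rho> \<xi>" "point_cloud_varifold d W"
    and "0 < mc_denominator \<epsilon> \<xi> W i"
    and inward: "\<And>j. norm (pos W j - pos W i) < \<epsilon> \<Longrightarrow>
                   Pi_op c W i j (pos W j - pos W i) \<bullet> \<nu> \<le> 0"
  shows "approx_mean_curvature d \<epsilon> \<rho> \<xi> c W i \<bullet> \<nu> \<le> 0"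
proof -
  let ?r = "\<lambda>j. norm (pos W j - pos W i)"
  let ?S = "\<Sum>j\<in>UNIV - {i}. (mass W j * deriv \<rho> (?r j / \<epsilon>)) *\<^sub>R
              Pi_op c W i j ((pos W j - pos W i) /\<^sub>R ?r j)"
  have sub: "subspace (dirn W j)" and mass: "0 < mass W j" for j
    using assms(3) unfolding point_cloud_varifold_def by auto
  have "0 \<le> (mass W j * deriv \<rho> (?r j / \<epsilon>)) *
              (inverse (?r j) * (Pi_op c W i j (pos W j - pos W i) \<bullet> \<nu>))" for j
  \<comment> \<open>These are the terms that vanish: for coinciding points because
    \<open>inverse 0 = 0\<close>, and outside the kernel range, where \<open>inward\<close> says
    nothing, because \<rho>' is zero. In every other term both factors are nonpositive.\<close>
  proof (cases "?r j = 0 \<or> \<epsilon> \<le> ?r j")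
    case True
    then show ?thesis
    proof
      assume "\<epsilon> \<le> ?r j"
      then have "deriv \<rho> (?r j / \<epsilon>) = 0"
        using assms(1,2) unfolding kernel_pair_def
        by (intro smoothing_profile_deriv_eq_0) auto
      then show ?thesis by simp
    qed simp
  next
    case False
    then have "deriv \<rho> (?r j / \<epsilon>) \<le> 0"
      using assms(1) by (intro kernel_pair_deriv_nonpos[OF assms(2)]) simp
    then have "mass W j * deriv \<rho> (?r j / \<epsilon>) \<le> 0"
      using mass[of j] by (simp add: mult_le_0_iff)
    moreover have "inverse (?r j) * (Pi_op c W i j (pos W j - pos W i) \<bullet> \<nu>) \<le> 0"
      using inward[of j] False by (intro mult_nonneg_nonpos) auto
    ultimately show ?thesis by (intro mult_nonpos_nonpos)
  qed
  then have "0 \<le> ?S \<bullet> \<nu>"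
    unfolding inner_sum_left inner_scaleR_left Pi_op_scaleR[OF sub sub] by (intro sum_nonneg)
  \<comment> \<open>The leading minus sign of the curvature turns the nonnegative sum into the
    claim; the scalar factors are nonnegative.\<close>
  then show ?thesis
    using assms(1,4) unfolding approx_mean_curvature_def by simp
qed

theorem proposition5p3:
  fixes d :: nat and \<epsilon> \<tau> \<mu> :: real
    and \<rho> \<xi> :: "real \<Rightarrow> real"
    and c :: projector_choice
    and mrule :: "('p::finite \<Rightarrow> real ^ 'n) \<Rightarrow> 'p \<Rightarrow> real"
    and Prule :: "('p \<Rightarrow> real ^ 'n) \<Rightarrow> 'p \<Rightarrow> (real ^ 'n) set"
    and K :: enat
    and V :: "nat \<Rightarrow> (real ^ 'n, 'p) point_cloud"
    and \<nu> :: "real ^ 'n"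
  assumes "1 \<le> d" and "d \<le> CARD('n)"
    and "0 < \<epsilon>" and "0 < \<tau>"
    and "kernel_pair CARD('n) \<rho> \<xi>"
    and "implicit_scheme_solution d \<epsilon> \<tau> \<rho> \<xi> c mrule Prule K V"
    and "\<forall>i. pos (V 0) i \<bullet> \<nu> \<le> \<mu>"
    and "implicit_inward_condition \<epsilon> c K V"
  shows "\<forall>k. enat k \<le> K \<longrightarrow> (\<forall>i. pos (V k) i \<bullet> \<nu> \<le> \<mu>)"
proof (cases "\<nu> = 0")
  \<comment> \<open>Maximality along \<nu> forces a boundary point only if \<nu> is nonzero. For
    \<nu> = 0 the initial bound already reads 0 \<le> \<mu>.\<close>
  case True
  with assms(7) show ?thesis by simp
next
  case False
  have "\<forall>i. pos (V k) i \<bullet> \<nu> \<le> \<mu>" if "enat k \<le> K" for k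
    using that
  proof (induction k)
    case 0
    then show ?case using assms(7) by simp
  next
    case (Suc k)
    have "enat k \<le> K"
      using Suc.prems by (meson enat_ord_simps(1) le_SucI order_refl order_trans)
    with Suc.IH have IH: "pos (V k) j \<bullet> \<nu> \<le> \<mu>" for j by blast
    let ?x = "pos (V (Suc k))"
    \<comment> \<open>New positions with the old masses and directions: \<open>Pi_op\<close> reads
      only the directions, so it is the same for \<open>?W\<close> as for
      \<open>V k\<close>.\<close>
    let ?W = "(V k)\<lparr>pos := ?x\<rparr>"
    let ?C = "convex hull (range ?x)"
    have "Max (range (\<lambda>j. ?x j \<bullet> \<nu>)) \<in> range (\<lambda>j. ?x j \<bullet> \<nu>)"
      by (intro Max_in) auto
    then obtain i where "?x i \<bullet> \<nu> = Max (range (\<lambda>j. ?x j \<bullet> \<nu>))"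
      by force
    then have i: "?x j \<bullet> \<nu> \<le> ?x i \<bullet> \<nu>" for j
      by simp
    have top: "y \<bullet> \<nu> \<le> ?x i \<bullet> \<nu>" if "y \<in> ?C" for y
      using inner_le_on_convex_hull[OF _ that] i by blast
    have "?x i \<in> frontier ?C"
      using maximizer_in_frontier[OF _ top False] by (simp add: hull_inc)
    then have "points_inside ?C (?x i) (Pi_op c (V k) i j (?x j - ?x i))"
      if "norm (?x j - ?x i) < \<epsilon>" for j
      using assms(8) Suc.prems that unfolding implicit_inward_condition_def Let_def by blast
    then have "Pi_op c (V k) i j (?x j - ?x i) \<bullet> \<nu> \<le> 0" if "norm (?x j - ?x i) < \<epsilon>" for j
      using points_inside_inner_nonpos[OF _ top] that by blast
    then have inward: "Pi_op c ?W i j (pos ?W j - pos ?W i) \<bullet> \<nu> \<le> 0"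
      if "norm (pos ?W j - pos ?W i) < \<epsilon>" for j
      using that by (simp add: Pi_op_def)
    have "point_cloud_varifold d (V k)"
      using assms(6) \<open>enat k \<le> K\<close> unfolding implicit_scheme_solution_def by blast
    then have "point_cloud_varifold d ?W"
      by (simp add: point_cloud_varifold_def)
    moreover have "0 < mc_denominator \<epsilon> \<xi> ?W i"
      and step: "?x i = pos (V k) i + \<tau> *\<^sub>R approx_mean_curvature d \<epsilon> \<rho> \<xi> c ?W i"
      using assms(6) Suc.prems unfolding implicit_scheme_solution_def Let_def by blast+
    ultimately have "approx_mean_curvature d \<epsilon> \<rho> \<xi> c ?W i \<bullet> \<nu> \<le> 0"
      using inward by (intro approx_mean_curvature_inner_nonpos[OF assms(3,5)])
    then have "\<tau> * (approx_mean_curvature d \<epsilon> \<rho> \<xi> c ?W i \<bullet> \<nu>) \<le> 0"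
      using \<open>0 < \<tau>\<close> by (simp add: mult_le_0_iff)
    moreover have "?x i \<bullet> \<nu> = pos (V k) i \<bullet> \<nu> + \<tau> * (approx_mean_curvature d \<epsilon> \<rho> \<xi> c ?W i \<bullet> \<nu>)"
      using arg_cong[OF step, of "\<lambda>u. u \<bullet> \<nu>"] unfolding inner_add_left inner_scaleR_left .
    \<comment> \<open>The label \<open>i\<close> was chosen to maximise the new heights; the
      induction hypothesis bounds the old height at this same label, whether or not it was
      maximal.\<close>
    ultimately have "?x i \<bullet> \<nu> \<le> \<mu>"
      using IH[of i] by linarith
    with i show ?case by (meson order_trans)
  qed
  then show ?thesis by blast
qed

end
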